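(* Let $98.195^\circ \le \alpha \le 108^\circ$. Then for every $n\in\mathbb{N}_0$ the paperfolding polygon $Q_n$ with unfolding angle $\alpha$ has no self-intersections; that is, for all $0\le j<k\le 2^n-1$, the segments $\overline{P_{n,j}P_{n,j+1}}$ and $\overline{P_{n,k}P_{n,k+1}}$ are disjoint if $k>j+1$, and meet only in the point $P_{n,j+1}$ if $k=j+1$.
   Context: The plane is identified with $\mathbb{C}$; angles are measured counterclockwise, in degrees ($e^{i\theta}$ denotes the unit vector with polar angle $\theta$). Given an unfolding angle $\alpha$ with $0^\circ<\alpha<180^\circ$, put $\beta = 90^\circ-\frac{\alpha}{2}$ and $q=\frac{1}{2\cos\beta}$. Paperfolding polygons: $Q_n$ is the polygonal path with vertices $P_{n,0},P_{n,1},\dots,P_{n,2^n}$ (in this order) and segments $\overline{P_{n,k}P_{n,k+1}}$, $0\le k\le 2^n-1$. One starts with $P_{0,0}=0$, $P_{0,1}=1$. Given $Q_n$, the polygon $Q_{n+1}$ is obtained by renumbering $P_{n+1,2k}=P_{n,k}$ and replacing each segment $\overline{P_{n,k}P_{n,k+1}}$ by the two equal sides of an isosceles triangle with that segment as base and apex $P_{n+1,2k+1}$ with apex angle $\alpha$, where the apex lies to the right of the directed segment from $P_{n,k}$ to $P_{n,k+1}$ if $k$ is even and to the left if $k$ is odd. Explicitly, $P_{n+1,2k+1}=P_{n,k}+q e^{-i\beta}(P_{n,k+1}-P_{n,k})$ for $k$ even and $P_{n+1,2k+1}=P_{n,k}+q e^{i\beta}(P_{n,k+1}-P_{n,k})$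 for $k$ odd. *)

theory Defs
  imports "HOL-Analysis.Analysis"
begin

text \<open>Angles are given in degrees; only \<open>cos_deg\<close> and \<open>cis_deg\<close> convert them to radians.\<close>

definition cos_deg :: "real \<Rightarrow> real" where
  "cos_deg \<theta> = cos (\<theta> * pi / 180)"

definition cis_deg :: "real \<Rightarrow> complex" where
  "cis_deg \<theta> = cis (\<theta> * pi / 180)"

text \<open>For unfolding angle \<open>\<alpha>\<close>, \<open>base_angle \<alpha>\<close> is the base angle of an isosceles triangle
  with apex angle \<open>\<alpha>\<close>, and \<open>leg_ratio \<alpha>\<close> is the ratio of its legs to its base.\<close>

definition base_angle :: "real \<Rightarrow> real" where
  "base_angle \<alpha> = 90 - \<alpha> / 2"

definition leg_ratio :: "real \<Rightarrow> real" where
  "leg_ratio \<alpha> = 1 / (2 * cos_deg (base_angle \<alpha>))"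

text \<open>\<open>vertex \<alpha> n k\<close> is the vertex number \<open>k\<close> of the \<open>n\<close>-th polygon.
  It is meaningful only for \<open>k \<le> 2 ^ n\<close>; values at larger \<open>k\<close> are junk.\<close>

primrec vertex :: "real \<Rightarrow> nat \<Rightarrow> nat \<Rightarrow> complex" where
  "vertex \<alpha> 0 m = (if m = 0 then 0 else 1)"
| "vertex \<alpha> (Suc n) m =
    (let k = m div 2 in
     if even m then vertex \<alpha> n k
     else vertex \<alpha> n k +
       complex_of_real (leg_ratio \<alpha>) *
       cis_deg (if even k then - base_angle \<alpha> else base_angle \<alpha>) *
       (vertex \<alpha> n (k + 1) - vertex \<alpha> n k))"

lemma vertex_Suc_even: "vertex \<alpha> (Suc n) (2 * k) = vertex \<alpha> n k"
  by simp

lemma vertex_Suc_odd: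
  "vertex \<alpha> (Suc n) (2 * k + 1) =
    (if even k
     then vertex \<alpha> n k + complex_of_real (leg_ratio \<alpha>) * cis_deg (- base_angle \<alpha>) *
            (vertex \<alpha> n (k + 1) - vertex \<alpha> n k)
     else vertex \<alpha> n k + complex_of_real (leg_ratio \<alpha>) * cis_deg (base_angle \<alpha>) *
            (vertex \<alpha> n (k + 1) - vertex \<alpha> n k))"
  by simp

definition edge :: "real \<Rightarrow> nat \<Rightarrow> nat \<Rightarrow> complex set" where
  "edge \<alpha> n k = closed_segment (vertex \<alpha> n k) (vertex \<alpha> n (k + 1))"

end

theory Submission
  imports Defs
begin

text \<open>Put \<open>t = tan \<beta>\<close>. The polygon \<open>Q\<^sub>n\<^sub>+\<^sub>1\<close> is the union of the two images of \<open>Q\<^sub>n\<close> under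
  \<open>z \<mapsto> w z\<close> and \<open>z \<mapsto> 1 - w' z\<close>, where \<open>w = (1 - i t) / 2\<close> and \<open>w'\<close> is its conjugate, so by
  induction it suffices that these images meet only in \<open>w\<close>. Let \<open>U\<close> be the union of all \<open>Q\<^sub>n\<close>. Using
  the self-similarity of the polygons around their end points, the claim is reduced to the
  disjointness of four pairs of similar copies of \<open>U\<close> (\<open>pieces_disjoint\<close>); it is not necessary
  to keep track of the levels \<open>n\<close>. For these pairs, \<open>U\<close> is enclosed in a disc, and whenever the
  discs of two copies overlap, the larger copy is subdivided by
  \<open>U = [0,1] \<union> w U \<union> (1 - w' U)\<close>. Since all distances involved are bounded away from 0, this
  terminates, and it can be done in integer arithmetic with error bounds, for five intervals
  of slopes \<open>t\<close> that together contain every slope that occurs.\<close>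

section \<open>The folding maps\<close>

text \<open>For t = tan \<beta> this is the factor q e^{-i \<beta>}, in a form that is affine in t;
  \<open>leg (- t)\<close> is q e^{i \<beta>}.\<close>

definition leg :: "real \<Rightarrow> complex" where
  "leg t = Complex (1/2) (- t/2)"

text \<open>\<open>Turn\<close> is the linear part of \<open>Fold1\<close>; it serves once the
  common point of the two halves has been moved to 0. \<open>Half0\<close> and \<open>Half1\<close>
  bisect the unit segment.\<close>

datatype move = Fold0 | Fold1 | Turn | Half0 | Half1

primrec act :: "real \<Rightarrow> move \<Rightarrow> complex \<Rightarrow> complex" where
  "act t Fold0 z = leg t * z"
| "act t Fold1 z = 1 - leg (- t) * z"
| "act t Turn z = - (leg (- t) * z)"
| "act t Half0 z = z / 2"
| "act t Half1 z = (1 + z) / 2"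

abbreviation acts :: "real \<Rightarrow> move list \<Rightarrow> complex \<Rightarrow> complex" where
  "acts t \<equiv> foldr (act t)"

primrec curve :: "real \<Rightarrow> nat \<Rightarrow> complex set" where
  "curve t 0 = closed_segment 0 1"
| "curve t (Suc n) = act t Fold0 ` curve t n \<union> act t Fold1 ` curve t n"

lemma leg_minus: "leg (- t) = 1 - leg t" "leg (- t) = cnj (leg t)"
  by (simp_all add: leg_def complex_eq_iff)

lemma leg_neq_0: "leg t \<noteq> 0"
  by (simp add: leg_def complex_eq_iff)

section \<open>Subdivision in integer arithmetic\<close>

text \<open>Centres and radii are scaled by 10000.\<close>

type_synonym ball = "int \<times> int \<times> int"

fun in_ball :: "complex \<Rightarrow> ball \<Rightarrow> bool" where
  "in_ball z (x, y, e) \<longleftrightarrow> cmod (10000 * z - Complex x y) \<le> e"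

text \<open>For slopes \<open>t\<close> with \<open>\<bar>10000 t - T\<bar> \<le> D\<close> and \<open>10000 \<bar>leg t\<bar> \<le> Q\<close>. Of the summand 3, two units
  pay for rounding the centre and one for rounding the radius.\<close>

fun leg_ball :: "int \<Rightarrow> int \<Rightarrow> int \<Rightarrow> ball \<Rightarrow> ball" where
  "leg_ball T D Q (x, y, e) =
     ((10000 * x + T * y) div 20000, (10000 * y - T * x) div 20000,
      (2 * Q * e + D * (\<bar>x\<bar> + \<bar>y\<bar>)) div 20000 + 3)"

fun neg_ball :: "ball \<Rightarrow> ball" where
  "neg_ball (x, y, e) = (- x, - y, e)"

fun inc_ball :: "ball \<Rightarrow> ball" where
  "inc_ball (x, y, e) = (x + 10000, y, e)"

text \<open>One of the two added units pays for rounding the centre, the other for rounding the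
  radius.\<close>

fun half_ball :: "ball \<Rightarrow> ball" where
  "half_ball (x, y, e) = (x div 2, y div 2, e div 2 + 2)"

fun move_ball :: "int \<Rightarrow> int \<Rightarrow> int \<Rightarrow> move \<Rightarrow> ball \<Rightarrow> ball" where
  "move_ball T D Q Fold0 b = leg_ball T D Q b"
| "move_ball T D Q Fold1 b = inc_ball (neg_ball (leg_ball (- T) D Q b))"
| "move_ball T D Q Turn b = neg_ball (leg_ball (- T) D Q b)"
| "move_ball T D Q Half0 b = half_ball b"
| "move_ball T D Q Half1 b = half_ball (inc_ball b)"

text \<open>A word of moves applied to the unit segment (\<open>True\<close>) or to the union of all curves (\<open>False\<close>).\<close>

type_synonym piece = "move list \<times> bool"

text \<open>The disc (5000, 0, 5000) has the unit segment as diameter; \<open>B\<close> is meant to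
  contain all curves.\<close>

definition piece_ball :: "int \<Rightarrow> int \<Rightarrow> int \<Rightarrow> ball \<Rightarrow> piece \<Rightarrow> ball" where
  "piece_ball T D Q B p =
     foldr (move_ball T D Q) (fst p) (if snd p then (5000, 0, 5000) else B)"

fun enclosed :: "ball \<Rightarrow> ball \<Rightarrow> bool" where
  "enclosed (x, y, e) (x', y', e') \<longleftrightarrow> e \<le> e' \<and> (x - x')\<^sup>2 + (y - y')\<^sup>2 \<le> (e' - e)\<^sup>2"

fun apart :: "ball \<Rightarrow> ball \<Rightarrow> bool" where
  "apart (x, y, e) (x', y', e') \<longleftrightarrow> (e + e')\<^sup>2 < (x - x')\<^sup>2 + (y - y')\<^sup>2"

definition rad :: "ball \<Rightarrow> int" where
  "rad b = snd (snd b)"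

text \<open>A word applies its last move first, so subdividing the base set appends a move.\<close>

definition children :: "piece \<Rightarrow> piece list" where
  "children p =
     (if snd p then [(fst p @ [Half0], True), (fst p @ [Half1], True)]
      else [(fst p @ [Fold0], False), (fst p @ [Fold1], False), (fst p, True)])"

text \<open>The number is fuel that bounds the depth of subdivision; running out of it counts as
  failure.\<close>

primrec separated :: "(piece \<Rightarrow> ball) \<Rightarrow> nat \<Rightarrow> piece \<Rightarrow> piece \<Rightarrow> bool" where
  "separated f 0 p p' = False"
| "separated f (Suc n) p p' =
    (if apart (f p) (f p') then True
     else if rad (f p') \<le> rad (f p) then list_all (\<lambda>c. separated f n c p') (children p)
     else list_all (\<lambda>c. separated f n p c) (children p'))"

text \<open>Since |leg t|^2 = (1 + t^2)/4, the inequality for \<open>Q\<close> bounds 10000 |leg t|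
  at the largest slope. The enclosures are the hypotheses of \<open>curve_in_ball\<close>. The first
  two separations serve \<open>turn_meets_at_0\<close>, the last two
  \<open>folds_meet_at_1\<close>.\<close>

definition certified :: "int \<times> int \<times> int \<times> ball \<Rightarrow> bool" where
  "certified = (\<lambda>(T, D, Q, B). let f = piece_ball T D Q B in
     0 \<le> T \<and> 0 \<le> D \<and> 0 \<le> Q \<and> 100000000 + (T + D)\<^sup>2 \<le> 4 * Q\<^sup>2 \<and>
     list_all (\<lambda>p. enclosed (f p) B)
       [([], True), ([Fold0], True), ([Fold1], True),
        ([Fold0, Fold0], False), ([Fold0, Fold1], False),
        ([Fold1, Fold0], False), ([Fold1, Fold1], False)] \<and>
     separated f 14 ([Fold0, Fold1], False) ([Turn], False) \<and>
     separated f 14 ([Fold0], False) ([Turn, Fold1], False) \<and>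
     separated f 14 ([Fold0, Fold0], False) ([Fold1], False) \<and>
     separated f 14 ([Fold0], False) ([Fold1, Fold0], False))"


text \<open>The discs come from a numerical search; their radii are about as small as \<open>certified\<close>
  permits.\<close>

lemma certified_slopes:
  "list_all certified
    [(6385, 615, 6104, (4324, 0, 6933)), (7300, 300, 6281, (4227, -1, 7023)),
     (7850, 250, 6435, (4142, -1, 7287)), (8250, 150, 6530, (4092, -86, 7398)),
     (8533, 133, 6617, (4048, -159, 7575))]"
  by code_simp

section \<open>Correctness of the disc arithmetic\<close>

lemma norm_floor_div:
  "cmod (Complex (real_of_int a / real_of_int k) (real_of_int b / real_of_int k) -
               Complex (a div k) (b div k)) \<le> 2"
proof -
  have *: "\<bar>real_of_int i / real_of_int k - (i div k)\<bar> \<le> 1" for i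
    using real_of_int_div4[of i k] real_of_int_div3[of i k] by simp
  have "cmod (Complex (real_of_int a / real_of_int k) (real_of_int b / real_of_int k) -
               Complex (a div k) (b div k)) \<le>
        \<bar>real_of_int a / real_of_int k - (a div k)\<bar> + \<bar>real_of_int b / real_of_int k - (b div k)\<bar>"
    by (rule order_trans[OF cmod_le]) simp
  with *[of a] *[of b] show ?thesis by linarith
qed

text \<open>The error is the sum of three parts: the old radius scaled by |leg t|, the deviation of
  t from the midpoint \<open>T\<close> times the size of the centre, and the rounding of the new
  centre.\<close>

lemma in_leg_ball:
  fixes t :: real
  assumes T: "\<bar>10000 * t - T\<bar> \<le> D" and Q: "10000 * cmod (leg t) \<le> Q" and z: "in_ball z b"
  shows "in_ball (leg t * z) (leg_ball T D Q b)"
proof -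
  obtain x y e where b: "b = (x, y, e)" by (cases b)
  define c where "c = Complex x y"
  define l where "l = leg (T / 10000)"
  define k where "k = (2 * Q * e + D * (\<bar>x\<bar> + \<bar>y\<bar>)) div 20000"
  define d where "d = Complex ((10000 * x + T * y) div 20000) ((10000 * y - T * x) div 20000)"
  have z': "cmod (10000 * z - c) \<le> e" using z by (simp add: b c_def)
  have "cmod (leg t * (10000 * z - c)) \<le> (Q / 10000) * e"
    unfolding norm_mult
    by (rule mult_mono) (use Q z' order_trans[OF norm_ge_zero z']
      order_trans[OF norm_ge_zero, of "10000 * leg t" Q] in \<open>auto simp: norm_mult\<close>)
  moreover have "cmod ((leg t - l) * c) \<le> (D / 20000) * (\<bar>x\<bar> + \<bar>y\<bar>)"
  proof -
    have "leg t - l = Complex 0 ((T - 10000 * t) / 20000)"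
      by (simp add: leg_def l_def complex_eq_iff)
    then have "cmod (leg t - l) \<le> D / 20000"
      using T by (simp add: cmod_def abs_minus_commute)
    moreover have "cmod c \<le> \<bar>x\<bar> + \<bar>y\<bar>"
      unfolding c_def using cmod_le[of "Complex x y"] by simp
    ultimately show ?thesis
      unfolding norm_mult by (intro mult_mono) (use T in auto)
  qed
  moreover have "cmod (l * c - d) \<le> 2"
  proof -
    have "l * c = Complex (real_of_int (10000 * x + T * y) / real_of_int 20000)
                          (real_of_int (10000 * y - T * x) / real_of_int 20000)"
      by (simp add: l_def c_def leg_def complex_eq_iff field_simps)
    then show ?thesis
      using norm_floor_div[of "10000 * x + T * y" 20000 "10000 * y - T * x"] by (simp add: d_def)
  qed
  moreover have "(Q / 10000) * e + (D / 20000) * (\<bar>x\<bar> + \<bar>y\<bar>) \<le> real_of_int k + 1"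
  proof -
    have "(Q / 10000) * e + (D / 20000) * (\<bar>x\<bar> + \<bar>y\<bar>) =
        real_of_int (2 * Q * e + D * (\<bar>x\<bar> + \<bar>y\<bar>)) / real_of_int 20000"
      by (simp add: field_simps)
    also have "\<dots> \<le> real_of_int k + 1"
      using real_of_int_div3[of "2 * Q * e + D * (\<bar>x\<bar> + \<bar>y\<bar>)" 20000]
      unfolding k_def by linarith
    finally show ?thesis by simp
  qed
  moreover have "cmod (leg t * (10000 * z - c) + (leg t - l) * c + (l * c - d)) \<le>
      cmod (leg t * (10000 * z - c)) + cmod ((leg t - l) * c) + cmod (l * c - d)"
    by norm
  ultimately have "cmod (leg t * (10000 * z - c) + (leg t - l) * c + (l * c - d)) \<le> k + 3"
    by simp
  also have "leg t * (10000 * z - c) + (leg t - l) * c + (l * c - d) = 10000 * (leg t * z) - d"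
    by (simp add: algebra_simps)
  finally have "cmod (10000 * (leg t * z) - d) \<le> k + 3" .
  then show ?thesis
    by (simp add: b k_def d_def)
qed

lemma in_neg_ball: "in_ball z b \<Longrightarrow> in_ball (- z) (neg_ball b)"
proof (cases b)
  case (fields x y e)
  have "10000 * (- z) - Complex (- x) (- y) = - (10000 * z - Complex x y)"
    by (simp add: complex_eq_iff)
  then have "cmod (10000 * (- z) - Complex (- x) (- y)) = cmod (10000 * z - Complex x y)"
    by (metis norm_minus_cancel)
  then show "in_ball z b \<Longrightarrow> in_ball (- z) (neg_ball b)"
    by (simp add: fields)
qed

lemma in_inc_ball: "in_ball z b \<Longrightarrow> in_ball (1 + z) (inc_ball b)"
proof (cases b)
  case (fields x y e)
  have "10000 * (1 + z) - Complex (x + 10000) y = 10000 * z - Complex x y"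
    by (simp add: complex_eq_iff)
  then show "in_ball z b \<Longrightarrow> in_ball (1 + z) (inc_ball b)"
    by (simp only: fields inc_ball.simps in_ball.simps of_int_add of_int_numeral)
qed

lemma in_half_ball:
  assumes "in_ball z b"
  shows "in_ball (z / 2) (half_ball b)"
proof -
  obtain x y e where b: "b = (x, y, e)" by (cases b)
  define a where "a = Complex (real_of_int x / real_of_int 2) (real_of_int y / real_of_int 2)"
  define d where "d = Complex (x div 2) (y div 2)"
  have "10000 * (z / 2) - a = (10000 * z - Complex x y) / 2"
    by (simp add: a_def complex_eq_iff field_simps)
  then have "cmod (10000 * (z / 2) - a) = cmod (10000 * z - Complex x y) / 2"
    by (simp only: norm_divide norm_numeral)
  then have *: "cmod (10000 * (z / 2) - a) \<le> real_of_int e / 2"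
    using assms by (simp add: b)
  have "cmod (a - d) \<le> 1"
  proof -
    \<comment> \<open>Division by 2 leaves remainder 0 or 1, so each coordinate is off by at most
      1/2 and the centre by at most 1, where \<open>norm_floor_div\<close> would give 2.\<close>
    have h: "\<bar>real_of_int i / real_of_int 2 - (i div 2)\<bar> \<le> 1/2" for i :: int
    proof -
      have "real_of_int i = 2 * real_of_int (i div 2) + real_of_int (i mod 2)"
        by (metis mult_div_mod_eq of_int_add of_int_mult of_int_numeral)
      moreover have "real_of_int (i mod 2) \<in> {0, 1}" by auto
      ultimately show ?thesis by (auto simp: abs_le_iff field_simps)
    qed
    have "cmod (a - d) \<le> \<bar>Re (a - d)\<bar> + \<bar>Im (a - d)\<bar>" by (rule cmod_le)
    also have "\<dots> \<le> 1" using h[of x] h[of y] by (simp add: a_def d_def)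
    finally show ?thesis .
  qed
  moreover have "real_of_int e / 2 \<le> (e div 2) + 1"
    using real_of_int_div3[of e 2] by simp
  moreover have "cmod (10000 * (z / 2) - d) \<le> cmod (10000 * (z / 2) - a) + cmod (a - d)"
    by norm
  ultimately have "cmod (10000 * (z / 2) - d) \<le> (e div 2) + 2"
    using * by linarith
  then show ?thesis
    by (simp add: b d_def)
qed

lemma in_move_ball:
  fixes t :: real
  assumes "\<bar>10000 * t - T\<bar> \<le> D" "10000 * cmod (leg t) \<le> Q" "in_ball z b"
  shows "in_ball (act t m z) (move_ball T D Q m b)"
proof -
  \<comment> \<open>The same \<open>D\<close> and \<open>Q\<close> work for -t and
    \<open>- T\<close>, because \<open>leg (- t)\<close> is the conjugate of
    \<open>leg t\<close>.\<close>
  have "in_ball (leg (- t) * z) (leg_ball (- T) D Q b)"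
    by (rule in_leg_ball) (use assms in \<open>simp_all add: leg_minus(2) abs_minus_commute\<close>)
  then have *: "in_ball (- (leg (- t) * z)) (neg_ball (leg_ball (- T) D Q b))"
    by (rule in_neg_ball)
  show ?thesis
    by (cases m) (use assms * in_inc_ball[OF *] in
        \<open>auto simp del: in_ball.simps intro: in_leg_ball in_half_ball in_inc_ball\<close>)
qed

lemma in_acts_ball:
  fixes t :: real
  assumes "\<bar>10000 * t - T\<bar> \<le> D" "10000 * cmod (leg t) \<le> Q" "in_ball z b"
  shows "in_ball (acts t ms z) (foldr (move_ball T D Q) ms b)"
  by (induction ms) (use assms in \<open>auto simp del: in_ball.simps intro: in_move_ball\<close>)

lemma in_unit_ball:
  assumes "z \<in> closed_segment 0 1"
  shows "in_ball z (5000, 0, 5000)"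
proof -
  obtain u where u: "z = of_real u" "0 \<le> u" "u \<le> 1"
    using assms by (auto simp: in_segment scaleR_conv_of_real)
  have "10000 * z - Complex 5000 0 = of_real (10000 * u - 5000)"
    by (simp add: u complex_eq_iff)
  then have "cmod (10000 * z - Complex 5000 0) = \<bar>10000 * u - 5000\<bar>"
    by (simp only: norm_of_real)
  then show ?thesis
    using u by simp
qed

lemma enclosedD:
  assumes "enclosed b b'" "in_ball z b"
  shows "in_ball z b'"
proof -
  obtain x y e x' y' e' where b: "b = (x, y, e)" "b' = (x', y', e')" by (metis prod_cases3)
  have "real_of_int ((x - x')\<^sup>2 + (y - y')\<^sup>2) \<le> real_of_int ((e' - e)\<^sup>2)" "0 \<le> real_of_int (e' - e)"
    using assms(1) by (simp_all only: b enclosed.simps of_int_le_iff) simp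
  then have "cmod (Complex x y - Complex x' y') \<le> e' - e"
    by (simp add: cmod_def real_le_lsqrt)
  moreover have "cmod (10000 * z - Complex x' y') \<le>
      cmod (10000 * z - Complex x y) + cmod (Complex x y - Complex x' y')"
    by norm
  ultimately show ?thesis
    using assms(2) by (simp add: b)
qed

lemma apartD:
  assumes "apart b b'" "in_ball z b" "in_ball z' b'"
  shows "z \<noteq> z'"
proof
  assume "z = z'"
  obtain x y e x' y' e' where b: "b = (x, y, e)" "b' = (x', y', e')" by (metis prod_cases3)
  have "cmod (Complex x y - Complex x' y') \<le>
      cmod (10000 * z - Complex x y) + cmod (10000 * z - Complex x' y')"
    by norm
  then have "cmod (Complex x y - Complex x' y') \<le> e + e'"
    using assms(2,3) \<open>z = z'\<close> by (simp add: b)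
  then have "(cmod (Complex x y - Complex x' y'))\<^sup>2 \<le> (real_of_int (e + e'))\<^sup>2"
    by (intro power_mono) auto
  then have "real_of_int ((x - x')\<^sup>2 + (y - y')\<^sup>2) \<le> real_of_int ((e + e')\<^sup>2)"
    by (simp add: cmod_power2)
  then show False
    using assms(1) by (simp only: b apart.simps of_int_le_iff)
qed

section \<open>Point sets of the pieces and correctness of the subdivision\<close>

definition base :: "real \<Rightarrow> bool \<Rightarrow> complex set" where
  "base t s = (if s then closed_segment 0 1 else (\<Union>n. curve t n))"

definition piece :: "real \<Rightarrow> piece \<Rightarrow> complex set" where
  "piece t p = acts t (fst p) ` base t (snd p)"

lemma unit_segment_halves:
  "closed_segment 0 1 \<subseteq> act t Half0 ` closed_segment 0 1 \<union> act t Half1 ` closed_segment 0 1"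
proof
  fix z :: complex
  assume "z \<in> closed_segment 0 1"
  then obtain u where u: "z = of_real u" "0 \<le> u" "u \<le> 1"
    by (auto simp: in_segment scaleR_conv_of_real)
  have seg: "of_real v \<in> closed_segment 0 (1::complex)" if "0 \<le> v" "v \<le> 1" for v
    using that by (auto simp: in_segment scaleR_conv_of_real intro!: exI[of _ v])
  show "z \<in> act t Half0 ` closed_segment 0 1 \<union> act t Half1 ` closed_segment 0 1"
  proof (cases "u \<le> 1/2")
    case True
    then have "z \<in> act t Half0 ` closed_segment 0 1"
      using u by (intro image_eqI[of _ _ "of_real (2 * u)"] seg) auto
    then show ?thesis by blast
  next
    case False
    then have "z \<in> act t Half1 ` closed_segment 0 1"
      using u by (intro image_eqI[of _ _ "of_real (2 * u - 1)"] seg) auto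
    then show ?thesis by blast
  qed
qed

text \<open>The union over all n absorbs the drop from level n+1 to n, so the same set occurs on
  both sides and can be subdivided repeatedly.\<close>

lemma union_curve:
  "(\<Union>n. curve t n) \<subseteq>
     closed_segment 0 1 \<union> act t Fold0 ` (\<Union>n. curve t n) \<union> act t Fold1 ` (\<Union>n. curve t n)"
proof
  fix z assume "z \<in> (\<Union>n. curve t n)"
  then obtain n where "z \<in> curve t n" by blast
  then show "z \<in> closed_segment 0 1 \<union> act t Fold0 ` (\<Union>n. curve t n) \<union> act t Fold1 ` (\<Union>n. curve t n)"
    by (cases n) (auto simp del: act.simps)
qed

lemma piece_children: "piece t p \<subseteq> (\<Union>c \<in> set (children p). piece t c)"
proof (cases "snd p")
  case True
  then show ?thesis
    using image_mono[OF unit_segment_halves, of "acts t (fst p)" t]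
    by (simp add: piece_def children_def base_def image_Un image_image)
next
  case False
  then show ?thesis
    using image_mono[OF union_curve, of "acts t (fst p)" t]
    by (simp add: piece_def children_def base_def image_Un image_image Un_ac)
qed

text \<open>The children of a piece cover it, so it is disjoint from another piece as soon as all
  its children are.\<close>

lemma separatedD:
  assumes "\<And>q z. z \<in> piece t q \<Longrightarrow> in_ball z (f q)" "separated f n p p'"
  shows "piece t p \<inter> piece t p' = {}"
  using assms(2)
proof (induction n arbitrary: p p')
  case (Suc n)
  consider "apart (f p) (f p')"
    | "\<forall>c \<in> set (children p). separated f n c p'"
    | "\<forall>c \<in> set (children p'). separated f n p c"
    using Suc.prems by (auto simp: list_all_iff split: if_splits)
  then show ?case
  proof cases
    case 1
    then show ?thesis using assms(1) apartD by blast
  next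
    case 2
    then show ?thesis using Suc.IH piece_children[of t p] by blast
  next
    case 3
    then show ?thesis using Suc.IH piece_children[of t p'] by blast
  qed
qed simp

text \<open>Invariance is only required for pairs of folds, since a disc that is invariant under single
  folds has to be considerably larger than the curves.\<close>

lemma curve_in_ball:
  fixes t :: real
  assumes T: "\<bar>10000 * t - T\<bar> \<le> D" and Q: "10000 * cmod (leg t) \<le> Q"
    and seg: "\<And>ms. ms \<in> {[], [Fold0], [Fold1]} \<Longrightarrow> enclosed (piece_ball T D Q B (ms, True)) B"
    and fold: "\<And>ms. ms \<in> {[Fold0, Fold0], [Fold0, Fold1], [Fold1, Fold0], [Fold1, Fold1]} \<Longrightarrow>
      enclosed (piece_ball T D Q B (ms, False)) B"
  shows "z \<in> curve t n \<Longrightarrow> in_ball z B"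
proof -
  have seg': "in_ball (acts t ms z) B" if "ms \<in> {[], [Fold0], [Fold1]}" "z \<in> closed_segment 0 1" for ms z
    by (rule enclosedD[OF seg[OF that(1)]])
      (simp add: piece_ball_def in_acts_ball[OF T Q in_unit_ball[OF that(2)]] del: in_ball.simps)
  have fold': "in_ball (acts t ms z) B"
    if "in_ball z B" "ms \<in> {[Fold0, Fold0], [Fold0, Fold1], [Fold1, Fold0], [Fold1, Fold1]}" for ms z
    by (rule enclosedD[OF fold[OF that(2)]])
      (simp add: piece_ball_def in_acts_ball[OF T Q that(1)] del: in_ball.simps)
  show "z \<in> curve t n \<Longrightarrow> in_ball z B"
  \<comment> \<open>Pairs of folds lead from level n to n+2, so levels 0 and 1 both start the
    induction; they consist of the unit segment and its two folds.\<close>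
  proof (induction n arbitrary: z rule: induct_nat_012)
    case 0
    then show ?case using seg'[of "[]"] by simp
  next
    case 1
    then show ?case using seg'[of "[Fold0]"] seg'[of "[Fold1]"] by auto
  next
    case (ge2 n)
    then obtain x ms where x: "x \<in> curve t n" and z: "z = acts t ms x"
      and ms: "ms \<in> {[Fold0, Fold0], [Fold0, Fold1], [Fold1, Fold0], [Fold1, Fold1]}"
    proof -
      from ge2.prems obtain m m' x where "x \<in> curve t n" "z = acts t [m, m'] x"
        "m \<in> {Fold0, Fold1}" "m' \<in> {Fold0, Fold1}"
        by (fastforce simp del: act.simps)
      then show thesis by (intro that[of x "[m, m']"]) auto
    qed
    show ?case
      unfolding z by (rule fold'[OF ge2.IH(1)[OF x] ms])
  qed
qed

lemma certifiedD:
  fixes t :: real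
  assumes "certified (T, D, Q, B)" and T: "\<bar>10000 * t - T\<bar> \<le> D"
  shows "piece t ([Fold0, Fold1], False) \<inter> piece t ([Turn], False) = {}"
    and "piece t ([Fold0], False) \<inter> piece t ([Turn, Fold1], False) = {}"
    and "piece t ([Fold0, Fold0], False) \<inter> piece t ([Fold1], False) = {}"
    and "piece t ([Fold0], False) \<inter> piece t ([Fold1, Fold0], False) = {}"
proof -
  have pos: "0 \<le> T" "0 \<le> D" "0 \<le> Q" "100000000 + (T + D)\<^sup>2 \<le> 4 * Q\<^sup>2"
    using assms(1) by (simp_all add: certified_def Let_def)
  \<comment> \<open>As \<open>T\<close> is nonnegative, |10000 t| is at most
    \<open>T + D\<close>.\<close>
  have Q: "10000 * cmod (leg t) \<le> Q"
  proof -
    have "(10000 * t)\<^sup>2 \<le> (real_of_int (T + D))\<^sup>2"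
      using T pos by (intro abs_le_square_iff[THEN iffD1]) auto
    moreover have "real_of_int (100000000 + (T + D)\<^sup>2) \<le> real_of_int (4 * Q\<^sup>2)"
      using pos(4) by (simp only: of_int_le_iff)
    moreover have "(10000 * cmod (leg t))\<^sup>2 = 25000000 + (10000 * t)\<^sup>2 / 4"
      by (simp add: power_mult_distrib cmod_power2 leg_def power_divide)
    ultimately have "(10000 * cmod (leg t))\<^sup>2 \<le> (real_of_int Q)\<^sup>2"
      by simp
    then show ?thesis
      by (rule power2_le_imp_le) (use pos(3) in simp)
  qed
  have inv: "\<forall>p \<in> set [([], True), ([Fold0], True), ([Fold1], True),
      ([Fold0, Fold0], False), ([Fold0, Fold1], False),
      ([Fold1, Fold0], False), ([Fold1, Fold1], False)]. enclosed (piece_ball T D Q B p) B"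
    using assms(1) unfolding certified_def Let_def prod.case list_all_iff by blast
  have seg: "enclosed (piece_ball T D Q B (ms, True)) B" if "ms \<in> {[], [Fold0], [Fold1]}" for ms
    by (rule bspec[OF inv]) (use that in auto)
  have fold: "enclosed (piece_ball T D Q B (ms, False)) B"
    if "ms \<in> {[Fold0, Fold0], [Fold0, Fold1], [Fold1, Fold0], [Fold1, Fold1]}" for ms
    by (rule bspec[OF inv]) (use that in auto)
  have "in_ball z (piece_ball T D Q B p)" if z: "z \<in> piece t p" for z p
  proof -
    obtain x where x: "x \<in> base t (snd p)" "z = acts t (fst p) x"
      using z by (auto simp: piece_def)
    have "in_ball x (if snd p then (5000, 0, 5000) else B)"
      using x(1) in_unit_ball[of x] curve_in_ball[OF T Q seg fold, of x]
      by (auto simp: base_def simp del: in_ball.simps split: if_splits)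
    from in_acts_ball[OF T Q this, of "fst p"] show ?thesis
      by (simp only: piece_ball_def x(2))
  qed
  note sep = separatedD[OF this]
  have *: "separated (piece_ball T D Q B) 14 ([Fold0, Fold1], False) ([Turn], False)"
    "separated (piece_ball T D Q B) 14 ([Fold0], False) ([Turn, Fold1], False)"
    "separated (piece_ball T D Q B) 14 ([Fold0, Fold0], False) ([Fold1], False)"
    "separated (piece_ball T D Q B) 14 ([Fold0], False) ([Fold1, Fold0], False)"
    using assms(1) unfolding certified_def Let_def prod.case by blast+
  show "piece t ([Fold0, Fold1], False) \<inter> piece t ([Turn], False) = {}"
    using * by (intro sep)
  show "piece t ([Fold0], False) \<inter> piece t ([Turn, Fold1], False) = {}"
    using * by (intro sep)
  show "piece t ([Fold0, Fold0], False) \<inter> piece t ([Fold1], False) = {}"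
    using * by (intro sep)
  show "piece t ([Fold0], False) \<inter> piece t ([Fold1, Fold0], False) = {}"
    using * by (intro sep)
qed

lemma pieces_disjoint:
  assumes "0.577 \<le> t" "t \<le> 0.8666"
  shows "piece t ([Fold0, Fold1], False) \<inter> piece t ([Turn], False) = {}"
    and "piece t ([Fold0], False) \<inter> piece t ([Turn, Fold1], False) = {}"
    and "piece t ([Fold0, Fold0], False) \<inter> piece t ([Fold1], False) = {}"
    and "piece t ([Fold0], False) \<inter> piece t ([Fold1, Fold0], False) = {}"
proof -
  have "\<exists>T D Q B. certified (T, D, Q, B) \<and> \<bar>10000 * t - real_of_int T\<bar> \<le> real_of_int D"
  proof -
    \<comment> \<open>The five intervals have the end points (T - D)/10000 and (T + D)/10000 of the
      certified data.\<close>
    consider "t \<le> 0.7" | "0.7 \<le> t" "t \<le> 0.76" | "0.76 \<le> t" "t \<le> 0.81"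
      | "0.81 \<le> t" "t \<le> 0.84" | "0.84 \<le> t" by linarith
    then show ?thesis
    proof cases
      case 1
      then show ?thesis using assms certified_slopes
        by (intro exI[of _ 6385] exI[of _ 615] exI[of _ 6104] exI[of _ "(4324, 0, 6933)"]) (simp add: abs_le_iff)
    next
      case 2
      then show ?thesis using assms certified_slopes
        by (intro exI[of _ 7300] exI[of _ 300] exI[of _ 6281] exI[of _ "(4227, -1, 7023)"]) (simp add: abs_le_iff)
    next
      case 3
      then show ?thesis using assms certified_slopes
        by (intro exI[of _ 7850] exI[of _ 250] exI[of _ 6435] exI[of _ "(4142, -1, 7287)"]) (simp add: abs_le_iff)
    next
      case 4
      then show ?thesis using assms certified_slopes
        by (intro exI[of _ 8250] exI[of _ 150] exI[of _ 6530] exI[of _ "(4092, -86, 7398)"]) (simp add: abs_le_iff)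
    next
      case 5
      then show ?thesis using assms certified_slopes
        by (intro exI[of _ 8533] exI[of _ 133] exI[of _ 6617] exI[of _ "(4048, -159, 7575)"]) (simp add: abs_le_iff)
    qed
  qed
  then obtain T D Q B where "certified (T, D, Q, B)" "\<bar>10000 * t - real_of_int T\<bar> \<le> real_of_int D"
    by blast
  from certifiedD[OF this] show "piece t ([Fold0, Fold1], False) \<inter> piece t ([Turn], False) = {}"
    and "piece t ([Fold0], False) \<inter> piece t ([Turn, Fold1], False) = {}"
    and "piece t ([Fold0, Fold0], False) \<inter> piece t ([Fold1], False) = {}"
    and "piece t ([Fold0], False) \<inter> piece t ([Fold1, Fold0], False) = {}" .
qed

section \<open>The two halves of a curve\<close>

lemma acts_in_piece: "x \<in> curve t n \<Longrightarrow> acts t ms x \<in> piece t (ms, False)"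
  by (auto simp: piece_def base_def)

text \<open>Both images start at 0. The disjoint pieces exclude that x or y lies in the far half of
  its curve. In the near halves x and y have a common factor \<open>leg t\<close>; cancelling it
  gives the same situation one level lower.\<close>

lemma turn_meets_at_0:
  assumes t: "0.577 \<le> t" "t \<le> 0.8666"
  shows "x \<in> curve t n \<Longrightarrow> y \<in> curve t n \<Longrightarrow> act t Fold0 x = act t Turn y \<Longrightarrow> x = 0 \<and> y = 0"
proof (induction n arbitrary: x y)
  case 0
  then obtain u v where "x = of_real u" "0 \<le> u" "y = of_real v" "0 \<le> v"
    by (auto simp: in_segment scaleR_conv_of_real)
  \<comment> \<open>The real parts u/2 and -v/2 agree only if both vanish.\<close>
  with 0(3) show ?case
    by (auto simp: leg_def complex_eq_iff)
next
  case (Suc n)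
  have x: "x \<notin> act t Fold1 ` curve t n"
  proof
    assume "x \<in> act t Fold1 ` curve t n"
    then have "act t Fold0 x \<in> piece t ([Fold0, Fold1], False)"
      using acts_in_piece[of _ t n "[Fold0, Fold1]"] by (auto simp del: act.simps)
    moreover have "act t Turn y \<in> piece t ([Turn], False)"
      using acts_in_piece[OF Suc.prems(2), of "[Turn]"] by (simp del: act.simps)
    ultimately show False
      using pieces_disjoint(1)[OF t] Suc.prems(3) by auto
  qed
  have y: "y \<notin> act t Fold1 ` curve t n"
  proof
    assume "y \<in> act t Fold1 ` curve t n"
    then have "act t Turn y \<in> piece t ([Turn, Fold1], False)"
      using acts_in_piece[of _ t n "[Turn, Fold1]"] by (auto simp del: act.simps)
    moreover have "act t Fold0 x \<in> piece t ([Fold0], False)"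
      using acts_in_piece[OF Suc.prems(1), of "[Fold0]"] by (simp del: act.simps)
    ultimately show False
      using pieces_disjoint(2)[OF t] Suc.prems(3) by auto
  qed
  obtain x' y' where "x' \<in> curve t n" "y' \<in> curve t n" "x = leg t * x'" "y = leg t * y'"
    using Suc.prems(1,2) x y by auto
  moreover from this have "act t Fold0 x' = act t Turn y'"
    using Suc.prems(3) leg_neq_0[of t]
    by (metis act.simps(1,3) minus_mult_right mult.left_commute mult_left_cancel)
  ultimately show ?case
    using Suc.IH by auto
qed

text \<open>Near the common point of the two halves both are \<open>Fold1\<close>-images, and dividing their
  equation by the leg turns it into the situation of \<open>turn_meets_at_0\<close>.\<close>

lemma folds_meet_at_1:
  assumes t: "0.577 \<le> t" "t \<le> 0.8666"
    and x: "x \<in> curve t n" and y: "y \<in> curve t n" and eq: "act t Fold0 x = act t Fold1 y"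
  shows "x = 1 \<and> y = 1"
proof (cases n)
  case 0
  then obtain u v where uv: "x = of_real u" "y = of_real v"
    using x y by (auto simp: in_segment scaleR_conv_of_real)
  with eq have "u / 2 = 1 - v / 2" "t * u = t * v"
    by (auto simp: leg_def complex_eq_iff)
  then have "u = 1" "v = 1" using t by auto
  then show ?thesis by (simp add: uv)
next
  case (Suc n)
  have "x \<notin> act t Fold0 ` curve t n"
  proof
    assume "x \<in> act t Fold0 ` curve t n"
    then have "act t Fold0 x \<in> piece t ([Fold0, Fold0], False)"
      using acts_in_piece[of _ t n "[Fold0, Fold0]"] by (auto simp del: act.simps)
    moreover have "act t Fold1 y \<in> piece t ([Fold1], False)"
      using acts_in_piece[OF y, of "[Fold1]"] by (simp del: act.simps)
    ultimately show False
      using pieces_disjoint(3)[OF t] eq by auto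
  qed
  moreover have "y \<notin> act t Fold0 ` curve t n"
  proof
    assume "y \<in> act t Fold0 ` curve t n"
    then have "act t Fold1 y \<in> piece t ([Fold1, Fold0], False)"
      using acts_in_piece[of _ t n "[Fold1, Fold0]"] by (auto simp del: act.simps)
    moreover have "act t Fold0 x \<in> piece t ([Fold0], False)"
      using acts_in_piece[OF x, of "[Fold0]"] by (simp del: act.simps)
    ultimately show False
      using pieces_disjoint(4)[OF t] eq by auto
  qed
  ultimately obtain x' y' where x': "x' \<in> curve t n" "y' \<in> curve t n"
    and xy: "x = 1 - leg (- t) * x'" "y = 1 - leg (- t) * y'"
    using x y Suc by auto
  \<comment> \<open>With this identity the constant terms on both sides of \<open>eq\<close>, which
    stand for the common point of the halves, cancel, and a factor \<open>leg (- t)\<close> splits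
    off.\<close>
  have "leg t = 1 - leg (- t)" by (simp add: leg_minus(1))
  then have "leg (- t) * (leg t * x' + leg (- t) * y') = 0"
    using eq by (simp add: xy algebra_simps)
  then have "act t Fold0 x' = act t Turn y'"
    using leg_neq_0[of "- t"] by (simp add: eq_neg_iff_add_eq_0)
  then have "x' = 0 \<and> y' = 0"
    using turn_meets_at_0[OF t x'] by simp
  then show ?thesis by (simp add: xy)
qed

section \<open>The polygons as curves\<close>

abbreviation slope :: "real \<Rightarrow> real" where
  "slope \<alpha> \<equiv> tan (base_angle \<alpha> * pi / 180)"

lemma leg_slope:
  assumes "cos_deg (base_angle \<alpha>) \<noteq> 0"
  shows "complex_of_real (leg_ratio \<alpha>) * cis_deg (- base_angle \<alpha>) = leg (slope \<alpha>)"
    and "complex_of_real (leg_ratio \<alpha>) * cis_deg (base_angle \<alpha>) = leg (- slope \<alpha>)"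
  using assms
  by (simp_all add: leg_def leg_ratio_def cis_deg_def cos_deg_def complex_eq_iff tan_def)

declare vertex.simps(2) [simp del]

lemma vertex_Suc_odd_leg:
  assumes "cos_deg (base_angle \<alpha>) \<noteq> 0"
  shows "vertex \<alpha> (Suc n) (Suc (2 * k)) = vertex \<alpha> n k +
    leg (if even k then slope \<alpha> else - slope \<alpha>) * (vertex \<alpha> n (Suc k) - vertex \<alpha> n k)"
  using vertex_Suc_odd[of \<alpha> n k] leg_slope[OF assms] by (simp split: if_splits)

lemma vertex_0: "vertex \<alpha> n 0 = 0"
proof (induction n)
  case (Suc n)
  then show ?case using vertex_Suc_even[of \<alpha> n 0] by simp
qed simp

lemma vertex_last: "vertex \<alpha> n (2 ^ n) = 1"
proof (induction n)
  case (Suc n)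
  then show ?case using vertex_Suc_even[of \<alpha> n "2 ^ n"] by simp
qed simp

text \<open>The apex rule commutes with multiplication by a constant, and the first half of Q_{n+1}
  is numbered like Q_n, so its apexes lie on the same sides.\<close>

lemma vertex_fold0:
  assumes "cos_deg (base_angle \<alpha>) \<noteq> 0"
  shows "k \<le> 2 ^ n \<Longrightarrow> vertex \<alpha> (Suc n) k = leg (slope \<alpha>) * vertex \<alpha> n k"
proof (induction n arbitrary: k)
  case 0
  then have "k = 0 \<or> k = Suc (2 * 0)" by auto
  then show ?case
    using vertex_Suc_odd_leg[OF assms, of 0 0] vertex_0[of \<alpha> "Suc 0"] by auto
next
  case (Suc n)
  show ?case
  proof (cases "even k")
    case True
    then obtain j where "k = 2 * j" by blast
    then show ?thesis
      using Suc.IH[of j] Suc.prems by (simp add: vertex_Suc_even)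
  next
    case False
    then obtain j where k: "k = Suc (2 * j)" by (metis oddE Suc_eq_plus1)
    then have "j < 2 ^ n" using Suc.prems by simp
    then show ?thesis
      using Suc.IH[of j] Suc.IH[of "Suc j"]
      by (simp add: k vertex_Suc_odd_leg[OF assms] right_diff_distrib distrib_left mult.left_commute)
  qed
qed

text \<open>The second half is numbered backwards. Reversing a segment swaps left and right, but the
  parity of its number changes too, so the side of each apex is preserved.\<close>

lemma vertex_fold1:
  assumes "cos_deg (base_angle \<alpha>) \<noteq> 0"
  shows "k \<le> 2 ^ n \<Longrightarrow> vertex \<alpha> (Suc n) (2 ^ Suc n - k) = 1 - leg (- slope \<alpha>) * vertex \<alpha> n k"
proof (induction n arbitrary: k)
  case 0
  then consider "k = 0" | "k = 1" by fastforce
  then show ?case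
  proof cases
    case 1
    then show ?thesis using vertex_last[of \<alpha> "Suc 0"] by (simp add: vertex_0)
  next
    case 2
    then show ?thesis
      using vertex_Suc_odd_leg[OF assms, of 0 0] by (simp add: leg_minus(1))
  qed
next
  case (Suc n)
  show ?case
  proof (cases "even k")
    case True
    then obtain j where k: "k = 2 * j" by blast
    then have "2 ^ Suc (Suc n) - k = 2 * (2 ^ Suc n - j)" by simp
    then show ?thesis
      using Suc.IH[of j] Suc.prems k by (simp add: vertex_Suc_even)
  next
    case False
    then obtain j where k: "k = Suc (2 * j)" by (metis oddE Suc_eq_plus1)
    then have j: "j < 2 ^ n" using Suc.prems by simp
    \<comment> \<open>\<open>i\<close> is the number of the reversed segment j. Its legs are
      measured from the other end, which replaces a factor l by 1 - l, that is, \<open>leg t\<close>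
      by \<open>leg (- t)\<close>.\<close>
    define i where "i = 2 ^ Suc n - Suc j"
    have i: "2 ^ Suc (Suc n) - k = Suc (2 * i)" "Suc i = 2 ^ Suc n - j" "even i \<longleftrightarrow> odd j"
      using j by (auto simp: i_def k)
    have e1: "vertex \<alpha> (Suc n) i = 1 - leg (- slope \<alpha>) * vertex \<alpha> n (Suc j)"
      using Suc.IH[of "Suc j"] j by (simp add: i_def)
    have e2: "vertex \<alpha> (Suc n) (Suc i) = 1 - leg (- slope \<alpha>) * vertex \<alpha> n j"
      using Suc.IH[of j] j by (simp add: i(2))
    show ?thesis
      unfolding i(1) unfolding k vertex_Suc_odd_leg[OF assms]
      by (simp add: i(3) e1 e2 leg_minus(1) algebra_simps)
  qed
qed

section \<open>Edges of the two halves\<close>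

lemma affine_image_segment:
  "(\<lambda>z. a + b * z) ` closed_segment x y = closed_segment (a + b * x) (a + b * (y :: complex))"
proof -
  have "closed_segment (b * x) (b * y) = (*) b ` closed_segment x y"
    by (rule closed_segment_linear_image) (simp add: bounded_linear.linear bounded_linear_mult_right)
  then show ?thesis
    using closed_segment_translation[of a "b * x" "b * y"] by (simp add: image_image)
qed

lemma edge_fold0:
  assumes "cos_deg (base_angle \<alpha>) \<noteq> 0" "k < 2 ^ n"
  shows "edge \<alpha> (Suc n) k = act (slope \<alpha>) Fold0 ` edge \<alpha> n k"
  using affine_image_segment[of 0 "leg (slope \<alpha>)"] assms
  by (simp add: edge_def vertex_fold0)

text \<open>\<open>Suc k\<close> appears because the reversed edge starts at the image of vertex
  k+1.\<close>

lemma edge_fold1: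
  assumes "cos_deg (base_angle \<alpha>) \<noteq> 0" "k < 2 ^ n"
  shows "edge \<alpha> (Suc n) (2 ^ Suc n - Suc k) = act (slope \<alpha>) Fold1 ` edge \<alpha> n k"
proof -
  have "2 ^ Suc n - Suc k + 1 = 2 ^ Suc n - k" using assms(2) by simp
  then have "edge \<alpha> (Suc n) (2 ^ Suc n - Suc k) =
      closed_segment (1 - leg (- slope \<alpha>) * vertex \<alpha> n (Suc k)) (1 - leg (- slope \<alpha>) * vertex \<alpha> n k)"
    using assms vertex_fold1[OF assms(1), of k n] vertex_fold1[OF assms(1), of "Suc k" n]
    by (simp add: edge_def)
  then show ?thesis
    using affine_image_segment[of 1 "- leg (- slope \<alpha>)" "vertex \<alpha> n k" "vertex \<alpha> n (Suc k)"]
    by (simp add: edge_def closed_segment_commute)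
qed

lemma fold_half_cases:
  assumes "k < 2 ^ Suc n"
  obtains "k < 2 ^ n" | i where "i < 2 ^ n" "k = 2 ^ Suc n - Suc i"
proof (cases "k < 2 ^ n")
  case False
  then show thesis using assms that(2)[of "2 ^ Suc n - Suc k"] by simp
qed (rule that(1))

lemma edge_subset_curve:
  assumes "cos_deg (base_angle \<alpha>) \<noteq> 0"
  shows "k < 2 ^ n \<Longrightarrow> edge \<alpha> n k \<subseteq> curve (slope \<alpha>) n"
proof (induction n arbitrary: k)
  case 0
  then show ?case by (simp add: edge_def)
next
  case (Suc n)
  from Suc.prems show ?case
  proof (cases rule: fold_half_cases)
    case 1
    then show ?thesis using Suc.IH[of k] by (simp add: edge_fold0[OF assms] image_mono le_supI1 del: act.simps)
  next
    case (2 i)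
    then show ?thesis
      using Suc.IH[of i] by (simp only: edge_fold1[OF assms] curve.simps) blast
  qed
qed

text \<open>Both folds are injective. This is used to show that the end point 1 lies on the last
  edge only.\<close>

lemma vertex_neq_Suc:
  assumes "cos_deg (base_angle \<alpha>) \<noteq> 0"
  shows "k < 2 ^ n \<Longrightarrow> vertex \<alpha> n k \<noteq> vertex \<alpha> n (Suc k)"
proof (induction n arbitrary: k)
  case (Suc n)
  from Suc.prems show ?case
  proof (cases rule: fold_half_cases)
    case 1
    then show ?thesis
      using Suc.IH[of k] leg_neq_0 by (simp add: vertex_fold0[OF assms])
  next
    case (2 i)
    then have "Suc k = 2 ^ Suc n - i" by simp
    then show ?thesis
      using Suc.IH[of i] leg_neq_0 2 vertex_fold1[OF assms, of i n] vertex_fold1[OF assms, of "Suc i" n]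
      by (simp del: power_Suc)
  qed
qed simp

text \<open>Two edges in the same half are the image of two edges of Q_n under an injective fold.
  Edges in different halves can share only the image of 1, and 1 lies on the last edge of Q_n
  alone.\<close>

lemma edges_meet:
  assumes c: "cos_deg (base_angle \<alpha>) \<noteq> 0" and t: "0.577 \<le> slope \<alpha>" "slope \<alpha> \<le> 0.8666"
  shows "j < k \<Longrightarrow> k < 2 ^ n \<Longrightarrow> edge \<alpha> n j \<inter> edge \<alpha> n k = (if k = Suc j then {vertex \<alpha> n k} else {})"
proof (induction n arbitrary: j k)
  case (Suc n)
  let ?N = "2 ^ n :: nat"
  have inj: "inj (act (slope \<alpha>) Fold0)" "inj (act (slope \<alpha>) Fold1)"
    by (auto simp: inj_def leg_neq_0)
  \<comment> \<open>An earlier edge through 1 would meet the last edge there, so by the induction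
    hypothesis 1 would be the first vertex of the last edge as well.\<close>
  have last: "i = ?N - 1" if "i < ?N" "1 \<in> edge \<alpha> n i" for i
  proof (rule ccontr)
    assume "i \<noteq> ?N - 1"
    then have i: "i < ?N - 1" "?N - 1 < ?N" using that(1) by auto
    have "1 \<in> edge \<alpha> n (?N - 1)"
      by (simp add: edge_def vertex_last)
    with that(2) have "1 \<in> edge \<alpha> n i \<inter> edge \<alpha> n (?N - 1)" by blast
    then have "1 = vertex \<alpha> n (?N - 1)"
      unfolding Suc.IH[OF i] by (simp split: if_splits)
    then show False
      using vertex_neq_Suc[OF c i(2)] by (simp add: vertex_last)
  qed
  from Suc.prems(2) show ?case
  proof (cases rule: fold_half_cases)
    case 1
    then have "edge \<alpha> (Suc n) j \<inter> edge \<alpha> (Suc n) k = act (slope \<alpha>) Fold0 ` (edge \<alpha> n j \<inter> edge \<alpha> n k)"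
      using Suc.prems(1) edge_fold0[OF c, of j n] edge_fold0[OF c, of k n] by (simp only: image_Int[OF inj(1)])
    then show ?thesis
      using 1 Suc.prems(1) Suc.IH[of j k] vertex_fold0[OF c, of "Suc j" n] by simp
  next
    case (2 i)
    from Suc.prems have "j < 2 ^ Suc n" by simp
    then show ?thesis
    proof (cases rule: fold_half_cases)
      case 1
      have meet: "x = 1 \<and> y = 1 \<and> j = ?N - 1 \<and> i = ?N - 1"
        if "x \<in> edge \<alpha> n j" "y \<in> edge \<alpha> n i" "act (slope \<alpha>) Fold0 x = act (slope \<alpha>) Fold1 y" for x y
      proof -
        have "x = 1 \<and> y = 1"
          using folds_meet_at_1[OF t _ _ that(3)] that(1,2)
            edge_subset_curve[OF c 1] edge_subset_curve[OF c \<open>i < ?N\<close>] by blast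
        then show ?thesis
          using last[OF 1] last[OF \<open>i < ?N\<close>] that(1,2) by simp
      qed
      have images: "edge \<alpha> (Suc n) j = act (slope \<alpha>) Fold0 ` edge \<alpha> n j"
        "edge \<alpha> (Suc n) k = act (slope \<alpha>) Fold1 ` edge \<alpha> n i"
        using edge_fold0[OF c 1] edge_fold1[OF c \<open>i < ?N\<close>] 2(2) by simp_all
      show ?thesis
      proof (cases "k = Suc j")
        case True
        with 1 2 have "j = ?N - 1" by auto
        then have "k = ?N" using True by simp
        then have "vertex \<alpha> (Suc n) k = leg (slope \<alpha>)"
          using vertex_fold0[OF c, of ?N n] by (simp add: vertex_last)
        moreover have "edge \<alpha> (Suc n) j \<inter> edge \<alpha> (Suc n) k \<subseteq> {act (slope \<alpha>) Fold0 1}"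
          unfolding images using meet by blast
        moreover have "vertex \<alpha> (Suc n) k \<in> edge \<alpha> (Suc n) j \<inter> edge \<alpha> (Suc n) k"
          using True by (simp add: edge_def)
        ultimately show ?thesis using True by auto
      next
        case False
        \<comment> \<open>If both were 2^n - 1, then k = 2^{n+1} - (i + 1) = 2^n = j + 1.\<close>
        have "j \<noteq> ?N - 1 \<or> i \<noteq> ?N - 1"
          using False 1 2 by auto
        then have "act (slope \<alpha>) Fold0 x \<noteq> act (slope \<alpha>) Fold1 y"
          if "x \<in> edge \<alpha> n j" "y \<in> edge \<alpha> n i" for x y
          using meet[OF that] by blast
        then have "edge \<alpha> (Suc n) j \<inter> edge \<alpha> (Suc n) k = {}"
          unfolding images by blast
        then show ?thesis using False by simp
      qed
    next
      case (2 i')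
      note i' = this and i = \<open>i < ?N\<close> \<open>k = 2 ^ Suc n - Suc i\<close>
      \<comment> \<open>Counting from the end reverses the order of the edges.\<close>
      have "i < i'" using i i' Suc.prems(1) by simp
      then have "edge \<alpha> n i' \<inter> edge \<alpha> n i = (if i' = Suc i then {vertex \<alpha> n i'} else {})"
        using Suc.IH[of i i'] i' by (simp add: Int_commute)
      moreover have "k = Suc j \<longleftrightarrow> i' = Suc i" using i i' \<open>i < i'\<close> by auto
      moreover have "vertex \<alpha> (Suc n) k = act (slope \<alpha>) Fold1 (vertex \<alpha> n (Suc i))"
        using vertex_fold1[OF c, of "Suc i" n] i by simp
      ultimately show ?thesis
        using i i' by (simp add: edge_fold1[OF c] image_Int[OF inj(2), symmetric] del: act.simps power_Suc)
    qed
  qed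
qed simp

section \<open>Range of the slopes\<close>

lemma le_tan:
  fixes x :: real
  assumes "0 \<le> x" "x < pi / 2"
  shows "x \<le> tan x"
proof -
  have "\<exists>d. ((\<lambda>u. tan u - u) has_real_derivative d) (at u) \<and> 0 \<le> d"
    if "0 \<le> u" "u \<le> x" for u
  proof (intro exI conjI)
    have c: "0 < cos u" using that assms by (intro cos_gt_zero_pi) auto
    then show "((\<lambda>u. tan u - u) has_real_derivative inverse ((cos u)\<^sup>2) - 1) (at u)"
      by (auto intro!: derivative_eq_intros)
    have "(cos u)\<^sup>2 \<le> 1" using c by (simp add: abs_square_le_1)
    then show "0 \<le> inverse ((cos u)\<^sup>2) - 1" using c by (simp add: one_le_inverse)
  qed
  from DERIV_nonneg_imp_nondecreasing[OF assms(1) this] show ?thesis by simp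
qed

lemma slope_bounds:
  assumes "98.195 \<le> \<alpha>" "\<alpha> \<le> 108"
  shows "cos_deg (base_angle \<alpha>) \<noteq> 0" "0.577 \<le> slope \<alpha>" "slope \<alpha> \<le> 0.8666"
proof -
  define x where "x = base_angle \<alpha> * pi / 180"
  have b: "36 \<le> base_angle \<alpha>" "base_angle \<alpha> \<le> 40.9025"
    using assms by (simp_all add: base_angle_def)
  \<comment> \<open>The lower bound is relaxed from 36 to 30 degrees, where the tangent is 1/sqrt 3;
    the upper one is 40.9025/180 in lowest terms.\<close>
  have lo: "pi / 6 \<le> x" and hi: "x \<le> 16361 / 72000 * pi"
    using b by (simp_all add: x_def field_simps)
  have x: "- (pi / 2) < x" "x < pi / 2"
    by (use lo hi pi_gt_zero in linarith)+
  then show "cos_deg (base_angle \<alpha>) \<noteq> 0"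
    using cos_gt_zero_pi[of x] by (simp add: cos_deg_def x_def)
  have "tan (pi / 6) \<le> tan x"
    using lo x by (intro tan_mono_le) auto
  moreover have "0.577 \<le> tan (pi / 6)"
  proof -
    have "sqrt 3 \<le> 1 / 0.577"
      by (rule real_le_lsqrt) (simp_all add: power2_eq_square)
    then show ?thesis by (simp add: tan_30 field_simps)
  qed
  ultimately show "0.577 \<le> slope \<alpha>"
    by (simp add: x_def)
  \<comment> \<open>Near 45 degrees \<open>d\<close> is small, so tan d \<ge> d is sharp enough.
    \<open>d\<close> is at least 1639/72000 pi > 0.071478, and (1 - 0.071478)/(1 + 0.071478) <
    0.8666.\<close>
  define d where "d = pi / 4 - x"
  have d: "0.071478 \<le> d" "d < pi / 2"
    using hi lo pi_approx unfolding d_def by (simp_all add: field_simps)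
  have "0.071478 \<le> tan d"
    by (rule order_trans[OF d(1) le_tan]) (use d in auto)
  moreover have "tan x = (1 - tan d) / (1 + tan d)"
  proof -
    have "cos d \<noteq> 0" using cos_gt_zero_pi[of d] d by simp
    moreover have "cos (pi / 4 - d) \<noteq> 0"
      using cos_gt_zero_pi[of x] x by (simp add: d_def)
    ultimately have "tan (pi / 4 - d) = (tan (pi / 4) - tan d) / (1 + tan (pi / 4) * tan d)"
      by (intro tan_diff) (auto simp: cos_45)
    then show ?thesis by (simp add: d_def tan_45)
  qed
  ultimately have "tan x \<le> 0.8666"
    by (simp add: pos_divide_le_eq)
  then show "slope \<alpha> \<le> 0.8666"
    by (simp add: x_def)
qed

theorem theorem1:
  fixes \<alpha> :: real and n :: nat
  assumes "98.195 \<le> \<alpha>" and "\<alpha> \<le> 108"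
  shows "\<forall>j k. j < k \<and> k \<le> 2 ^ n - 1 \<longrightarrow>
           (k > j + 1 \<longrightarrow> edge \<alpha> n j \<inter> edge \<alpha> n k = {}) \<and>
           (k = j + 1 \<longrightarrow> edge \<alpha> n j \<inter> edge \<alpha> n k = {vertex \<alpha> n (j + 1)})"
proof (intro allI impI)
  fix j k :: nat
  assume "j < k \<and> k \<le> 2 ^ n - 1"
  \<comment> \<open>Subtraction on the naturals is truncated; positivity of 2^n turns the bound into
    k < 2^n.\<close>
  moreover have "0 < (2 :: nat) ^ n" by simp
  ultimately have "j < k" "k < 2 ^ n" by linarith+
  from edges_meet[OF slope_bounds[OF assms] this]
  show "(k > j + 1 \<longrightarrow> edge \<alpha> n j \<inter> edge \<alpha> n k = {}) \<and>
        (k = j + 1 \<longrightarrow> edge \<alpha> n j \<inter> edge \<alpha> n k = {vertex \<alpha> n (j + 1)})"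
    by auto
qed

end
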